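(* Let $d,L,N\ge 1$, let $\{X^{(1)},\dots,X^{(N)}\}$ be a batch of $N$ multivariate time series with $d$ components, and let $w^{(1)},\dots,w^{(N)}$ be real values with $\sum_{i=1}^N w^{(i)}=1$. Put $\mathbf{x}^{(i)}:=\mathsf{IIS}_{\le L}(X^{(i)})\in\mathcal{G}_{\le L}(\mathbb{R}^d)$, let $\mathbf{m}$ be the group mean of this dataset with weights $w^{(i)}$, and put $\mathbf{a}:=\mathbf{m}^{-1}$. Then $$\mathbf{a}_1=-\sum_{i=1}^N w^{(i)}(\mathbf{x}^{(i)})_1,$$ and for any $K=2,\dots,L$, $$\mathbf{a}_K=-\sum_{i=1}^N w^{(i)}\Big(q_K\big(\mathbf{a}_0,\dots,\mathbf{a}_{K-1},(\mathbf{x}^{(i)})_1,\dots,(\mathbf{x}^{(i)})_K\big)+p_K\big(\mathbf{a}_0,\dots,\mathbf{a}_{K-1},(\mathbf{x}^{(i)})_1,\dots,(\mathbf{x}^{(i)})_{K-1}\big)\Big),$$ where $p_K$ and $q_K$ are (noncommutative) polynomial functions.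
   Context: $T_{\le L}(\mathbb{R}^d)=\bigoplus_{k=0}^L(\mathbb{R}^d)^{\otimes k}$ with the truncated tensor (concatenation) product $(\mathbf{a}\mathbf{x})_K=\sum_{\ell=0}^K\mathbf{a}_\ell\otimes\mathbf{x}_{K-\ell}$, $0\le K\le L$, and unit $\mathsf{e}=(1,0,\dots,0)$. $\mathfrak{g}_{\le L}(\mathbb{R}^d)$ is the smallest sub-Lie algebra (for the commutator) containing $\mathbb{R}^d$, and $\mathcal{G}_{\le L}(\mathbb{R}^d)=\exp(\mathfrak{g}_{\le L}(\mathbb{R}^d))$ is the free step-$L$ nilpotent Lie group. A lower index denotes the tensor level: $\mathbf{g}=(\mathbf{g}_0,\dots,\mathbf{g}_L)$ with $\mathbf{g}_k\in(\mathbb{R}^d)^{\otimes k}$ and $\mathbf{g}_0=1$ for $\mathbf{g}\in\mathcal{G}_{\le L}(\mathbb{R}^d)$. For $\mathsf{e}+\mathbf{g}\in\mathcal{G}_{\le L}(\mathbb{R}^d)$: $(\mathsf{e}+\mathbf{g})^{-1}=\sum_{k=0}^L(-1)^k\mathbf{g}^k$ and $\log(\mathsf{e}+\mathbf{g})=\sum_{k=1}^L\frac{(-1)^{k+1}}{k}\mathbf{g}^k$. $\mathsf{IIS}_{\le L}(X)=\sum_{|w|\le L}c_w\,w$ is the iterated-integrals signature of (the path of) $X$ on $[0,\tau]$, $c_{w_1\cdots w_k}=\int_{0\le t_1\le\cdots\le t_k\le\tau}\mathrm dX^{(w_1)}_{t_1}\cdots\mathrm dX^{(w_k)}_{t_k}$;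 it lies in $\mathcal{G}_{\le L}(\mathbb{R}^d)$. The group mean with weights $w^{(i)}$ is the element $\mathbf{m}\in\mathcal{G}_{\le L}(\mathbb{R}^d)$ with $\sum_{i=1}^N w^{(i)}\log(\mathbf{m}^{-1}\mathbf{x}^{(i)})=0$. "Noncommutative polynomial function" means a map with values in $(\mathbb{R}^d)^{\otimes K}$ that is a fixed finite real linear combination (independent of the data) of tensor products of its arguments. *)

theory Defs
  imports "HOL-Analysis.Analysis" "HOL-Library.Function_Algebras"
begin

section \<open>The truncated tensor algebra\<close>

text \<open>
  A tensor is given by its coordinates in the word basis: the letters are the indices of the
  coordinates of \<open>real ^ 'd\<close>, and the word \<open>[w\<^sub>1, \<dots>, w\<^sub>k]\<close> stands for the elementary tensor
  \<open>e\<^bsub>w\<^sub>1\<^esub> \<otimes> \<dots> \<otimes> e\<^bsub>w\<^sub>k\<^esub>\<close>. Addition, zero, negation and finite sums are the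
  pointwise ones; the pointwise multiplication and unit of functions are never used.
\<close>

type_synonym 'd tensor = "'d list \<Rightarrow> real"

definition tscale :: "real \<Rightarrow> 'd tensor \<Rightarrow> 'd tensor" (infixr "*\<^sub>t" 75) where
  "c *\<^sub>t x = (\<lambda>w. c * x w)"

text \<open>The homogeneous tensors of level \<open>k\<close>, i.e. the \<open>k\<close>-th tensor power of \<open>real ^ 'd\<close>.\<close>

definition homogeneous :: "nat \<Rightarrow> 'd tensor set" where
  "homogeneous k = {x. \<forall>w. length w \<noteq> k \<longrightarrow> x w = 0}"

definition lvl :: "nat \<Rightarrow> 'd tensor \<Rightarrow> 'd tensor" where
  "lvl k x = (\<lambda>w. if length w = k then x w else 0)"

definition trunc_tensors :: "nat \<Rightarrow> 'd tensor set" where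
  "trunc_tensors L = {x. \<forall>w. L < length w \<longrightarrow> x w = 0}"

definition tunit :: "'d tensor" where
  "tunit = (\<lambda>w. if w = [] then 1 else 0)"

text \<open>
  The tensor product in coordinates: the coefficient of \<open>w\<close> sums over all splittings of \<open>w\<close>.
  For \<open>a\<close> homogeneous of level \<open>j\<close> only the splitting after \<open>j\<close> letters contributes.
\<close>

definition tensor_prod :: "'d tensor \<Rightarrow> 'd tensor \<Rightarrow> 'd tensor" (infixr "\<otimes>\<^sub>t" 70) where
  "a \<otimes>\<^sub>t b = (\<lambda>w. \<Sum>j\<le>length w. a (take j w) * b (drop j w))"

definition tmult :: "nat \<Rightarrow> 'd tensor \<Rightarrow> 'd tensor \<Rightarrow> 'd tensor" where
  "tmult L a x = (\<Sum>K\<le>L. \<Sum>l\<le>K. lvl l a \<otimes>\<^sub>t lvl (K - l) x)"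

primrec tpower :: "nat \<Rightarrow> 'd tensor \<Rightarrow> nat \<Rightarrow> 'd tensor" where
  "tpower L x 0 = tunit"
| "tpower L x (Suc k) = tmult L x (tpower L x k)"

definition texp :: "nat \<Rightarrow> 'd tensor \<Rightarrow> 'd tensor" where
  "texp L x = (\<Sum>k\<le>L. (1 / fact k) *\<^sub>t tpower L x k)"

definition tinverse :: "nat \<Rightarrow> 'd tensor \<Rightarrow> 'd tensor" where
  "tinverse L x = (\<Sum>k\<le>L. (-1) ^ k *\<^sub>t tpower L (x - tunit) k)"

definition tlog :: "nat \<Rightarrow> 'd tensor \<Rightarrow> 'd tensor" where
  "tlog L x = (\<Sum>k=1..L. ((-1) ^ (k + 1) / real k) *\<^sub>t tpower L (x - tunit) k)"


section \<open>The free step-\<open>L\<close> nilpotent Lie group\<close>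

definition lie_subalgebra :: "nat \<Rightarrow> 'd tensor set \<Rightarrow> bool" where
  "lie_subalgebra L V \<longleftrightarrow>
     V \<subseteq> trunc_tensors L \<and> 0 \<in> V \<and>
     (\<forall>x\<in>V. \<forall>y\<in>V. x + y \<in> V) \<and>
     (\<forall>c. \<forall>x\<in>V. c *\<^sub>t x \<in> V) \<and>
     (\<forall>x\<in>V. \<forall>y\<in>V. tmult L x y - tmult L y x \<in> V)"

definition free_lie_algebra :: "nat \<Rightarrow> 'd tensor set" where
  "free_lie_algebra L = \<Inter> {V. lie_subalgebra L V \<and> homogeneous 1 \<subseteq> V}"

definition free_lie_group :: "nat \<Rightarrow> 'd tensor set" where
  "free_lie_group L = texp L ` free_lie_algebra L"

text \<open>
  For \<open>x\<close> with values in the group and weights of sum 1 there is exactly one group mean;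
  it is characterised here as a relation.
\<close>

definition is_group_mean ::
    "nat \<Rightarrow> nat \<Rightarrow> (nat \<Rightarrow> real) \<Rightarrow> (nat \<Rightarrow> 'd tensor) \<Rightarrow> 'd tensor \<Rightarrow> bool" where
  "is_group_mean L N wt x m \<longleftrightarrow>
     m \<in> free_lie_group L \<and>
     (\<Sum>i=1..N. wt i *\<^sub>t tlog L (tmult L (tinverse L m) (x i))) = 0"


section \<open>Iterated-integrals signature\<close>

text \<open>Riemann--Stieltjes integral of \<open>f\<close> against \<open>g\<close>, as a limit over the mesh size.\<close>

definition has_stieltjes_integral ::
    "(real \<Rightarrow> real) \<Rightarrow> (real \<Rightarrow> real) \<Rightarrow> real \<Rightarrow> real \<Rightarrow> real \<Rightarrow> bool" where
  "has_stieltjes_integral f g a b I \<longleftrightarrow>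
     (\<forall>e>0. \<exists>\<delta>>0. \<forall>D. D tagged_division_of {a..b} \<and> (\<lambda>s. ball s \<delta>) fine D \<longrightarrow>
        \<bar>(\<Sum>(s, k)\<in>D. f s * (g (Sup k) - g (Inf k))) - I\<bar> < e)"

definition stieltjes_integral ::
    "(real \<Rightarrow> real) \<Rightarrow> (real \<Rightarrow> real) \<Rightarrow> real \<Rightarrow> real \<Rightarrow> real" where
  "stieltjes_integral f g a b = (THE I. has_stieltjes_integral f g a b I)"

text \<open>
  \<open>rev_iterated_integral X [w\<^sub>k, \<dots>, w\<^sub>1] t\<close> is the integral of
  \<open>dX\<^bsup>(w\<^sub>1)\<^esup> \<dots> dX\<^bsup>(w\<^sub>k)\<^esup>\<close> over
  \<open>0 \<le> t\<^sub>1 \<le> \<dots> \<le> t\<^sub>k \<le> t\<close>; the outermost integral belongs to the last letter of the word,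
  hence the reversal.
\<close>

primrec rev_iterated_integral :: "(real \<Rightarrow> real ^ 'd) \<Rightarrow> 'd list \<Rightarrow> real \<Rightarrow> real" where
  "rev_iterated_integral X [] = (\<lambda>t. 1)"
| "rev_iterated_integral X (j # v) =
     (\<lambda>t. stieltjes_integral (rev_iterated_integral X v) (\<lambda>s. X s $ j) 0 t)"

definition IIS :: "nat \<Rightarrow> real \<Rightarrow> (real \<Rightarrow> real ^ 'd) \<Rightarrow> 'd tensor" where
  "IIS L \<tau> X = (\<lambda>w. if length w \<le> L then rev_iterated_integral X (rev w) \<tau> else 0)"

text \<open>
  The paths for which these integrals are taken: continuous and of bounded variation. This
  covers in particular piecewise continuously differentiable paths and the piecewise linear
  interpolation of a finite sequence of samples, see \<open>bv_path_lipschitz\<close>.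
\<close>

definition bv_path :: "real \<Rightarrow> (real \<Rightarrow> real ^ 'd) \<Rightarrow> bool" where
  "bv_path \<tau> X \<longleftrightarrow> continuous_on {0..\<tau>} X \<and>
     (\<exists>B. \<forall>D. D division_of {0..\<tau>} \<longrightarrow> (\<Sum>k\<in>D. norm (X (Sup k) - X (Inf k))) \<le> B)"

lemma bv_path_lipschitz:
  fixes X :: "real \<Rightarrow> real ^ 'd"
  assumes "C-lipschitz_on {0..\<tau>} X"
  shows "bv_path \<tau> X"
proof -
  have "(\<Sum>k\<in>D. norm (X (Sup k) - X (Inf k))) \<le> C * measure lborel {0..\<tau>}"
    if D: "D division_of {0..\<tau>}" for D
  proof -
    have "norm (X (Sup k) - X (Inf k)) \<le> C * measure lborel k" if k: "k \<in> D" for k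
    proof -
      obtain a b where ab: "k = {a..b}"
        using division_ofD(4)[OF D k] by auto
      with division_ofD(2,3)[OF D k] have "a \<le> b" "a \<in> {0..\<tau>}" "b \<in> {0..\<tau>}" by auto
      then show ?thesis
        using lipschitz_onD[OF assms, of b a] ab by (simp add: dist_norm)
    qed
    then have "(\<Sum>k\<in>D. norm (X (Sup k) - X (Inf k))) \<le> (\<Sum>k\<in>D. C * measure lborel k)"
      by (rule sum_mono)
    also have "\<dots> = C * measure lborel {0..\<tau>}"
      using additive_content_division[of D 0 \<tau>] D by (simp flip: sum_distrib_left)
    finally show ?thesis .
  qed
  then show ?thesis
    unfolding bv_path_def using lipschitz_on_continuous_on[OF assms] by blast
qed

lemma has_stieltjes_integral_unique:
  assumes "has_stieltjes_integral f g a b I" "has_stieltjes_integral f g a b J"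
  shows "I = J"
proof (rule ccontr)
  assume "I \<noteq> J"
  define e where "e = \<bar>I - J\<bar> / 2"
  have e: "e > 0" using \<open>I \<noteq> J\<close> by (simp add: e_def)
  let ?S = "\<lambda>D. \<Sum>(s, k)\<in>D. f s * (g (Sup k) - g (Inf k))"
  obtain d1 where d1: "d1 > 0"
      "\<And>D. D tagged_division_of {a..b} \<Longrightarrow> (\<lambda>s. ball s d1) fine D \<Longrightarrow> \<bar>?S D - I\<bar> < e"
    using assms(1)[unfolded has_stieltjes_integral_def, rule_format, OF e] by blast
  obtain d2 where d2: "d2 > 0"
      "\<And>D. D tagged_division_of {a..b} \<Longrightarrow> (\<lambda>s. ball s d2) fine D \<Longrightarrow> \<bar>?S D - J\<bar> < e"
    using assms(2)[unfolded has_stieltjes_integral_def, rule_format, OF e] by blast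
  have "gauge (\<lambda>s::real. ball s (min d1 d2))"
    using d1(1) d2(1) by (simp add: gauge_def)
  then obtain D where "D tagged_division_of cbox a b" "(\<lambda>s. ball s (min d1 d2)) fine D"
    by (rule fine_division_exists)
  moreover from this have "(\<lambda>s. ball s d1) fine D" "(\<lambda>s. ball s d2) fine D"
    by (fastforce simp: fine_def subset_iff)+
  ultimately have "\<bar>?S D - I\<bar> < e" "\<bar>?S D - J\<bar> < e"
    using d1(2) d2(2) by auto
  moreover have "\<bar>I - J\<bar> \<le> \<bar>?S D - I\<bar> + \<bar>?S D - J\<bar>"
    using abs_triangle_ineq4[of "?S D - J" "?S D - I"] by (simp add: algebra_simps)
  ultimately show False by (simp add: e_def)
qed

lemma stieltjes_integral_eq: "has_stieltjes_integral f g a b I \<Longrightarrow> stieltjes_integral f g a b = I"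
  unfolding stieltjes_integral_def using has_stieltjes_integral_unique by blast

lemma IIS_single:
  assumes "0 \<le> \<tau>" "1 \<le> L"
  shows "IIS L \<tau> X [j] = X \<tau> $ j - X 0 $ j"
proof -
  have "has_stieltjes_integral (\<lambda>t. 1) (\<lambda>s. X s $ j) 0 \<tau> (X \<tau> $ j - X 0 $ j)"
    unfolding has_stieltjes_integral_def
    using additive_tagged_division_1[OF assms(1), where f = "\<lambda>s. X s $ j"]
    by (auto intro!: exI[of _ 1])
  then show ?thesis
    using assms(2) by (simp add: IIS_def stieltjes_integral_eq)
qed


section \<open>Noncommutative polynomial functions\<close>

definition tensor_prod_list :: "'d tensor list \<Rightarrow> 'd tensor" where
  "tensor_prod_list xs = foldr tensor_prod xs tunit"

text \<open>
  \<open>nc_polynomial ks K F\<close>: on arguments \<open>[x\<^sub>0, x\<^sub>1, \<dots>]\<close>, where \<open>x\<^sub>j\<close> is homogeneous of level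
  \<open>ks ! j\<close>, \<open>F\<close> is a fixed linear combination of tensor products of arguments. The list \<open>P\<close>
  holds the coefficient and the sequence of argument positions of each of its terms; the levels in
  each term add up to \<open>K\<close>, so that it takes values in the \<open>K\<close>-th tensor power.
\<close>

definition nc_polynomial :: "nat list \<Rightarrow> nat \<Rightarrow> ('d tensor list \<Rightarrow> 'd tensor) \<Rightarrow> bool" where
  "nc_polynomial ks K F \<longleftrightarrow>
     (\<exists>P :: (real \<times> nat list) list.
        (\<forall>(c, js)\<in>set P. set js \<subseteq> {..<length ks} \<and> (\<Sum>j\<leftarrow>js. ks ! j) = K) \<and>
        (\<forall>xs. length xs = length ks \<and> (\<forall>j<length ks. xs ! j \<in> homogeneous (ks ! j)) \<longrightarrow>
           F xs = (\<Sum>(c, js)\<leftarrow>P. c *\<^sub>t tensor_prod_list (map ((!) xs) js))))"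

end

theory Submission
  imports Defs
begin

text \<open>
  The elements \<open>a = m\<^sup>-\<^sup>1\<close> and \<open>x\<close> (one of the \<open>x\<^sup>(\<^sup>i\<^sup>)\<close>) have constant term \<open>1\<close>, hence so has
  \<open>y = a x\<close>. The point is that both the product and the logarithm are triangular with respect to the
  level. Level \<open>K\<close> of \<open>y\<close> is \<open>a\<^sub>K \<otimes> x\<^sub>0 = a\<^sub>K\<close> plus \<open>q\<^sub>K = (\<Sum>l<K. a\<^sub>l \<otimes> x\<^bsub>K-l\<^esub>)\<close>.
  Level \<open>K\<close> of \<open>log y\<close> is \<open>y\<^sub>K\<close> plus the contribution \<open>p\<^sub>K\<close> of the powers \<open>(y - e)\<^sup>k\<close> with
  \<open>k \<ge> 2\<close>; as \<open>y - e\<close> has no constant term, these products involve only \<open>y\<^sub>1, \<dots>, y\<^bsub>K-1\<^esub>\<close>,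
  and so only the levels of \<open>a\<close> and \<open>x\<close> below \<open>K\<close> (lemmas \<open>lvl_tlog\<close> and \<open>lvl_tlog_tmult\<close>).

  The equation of the group mean thus reads, at level \<open>K\<close>,
  \<open>(\<Sum>i. w\<^sub>i (a\<^sub>K + q\<^sub>K + p\<^sub>K)) = 0\<close>, where \<open>a\<^sub>K\<close> does not depend on \<open>i\<close>; since the weights add
  up to \<open>1\<close>, it can be solved for \<open>a\<^sub>K\<close>.

  That \<open>p\<^sub>K\<close> and \<open>q\<^sub>K\<close> are noncommutative polynomials follows from the closure of these under sums
  and tensor products. Closure under products rests on the associativity of the tensor product,
  which makes the product of two terms the term of the concatenated index lists.
\<close>

section \<open>Algebra of tensors\<close>

lemma tensor_sum_apply: "(\<Sum>i\<in>A. f i) w = (\<Sum>i\<in>A. f i w)" for f :: "'i \<Rightarrow> 'd tensor"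
  by (induction A rule: infinite_finite_induct) auto

lemma tscale_apply [simp]: "(c *\<^sub>t x) w = c * x w"
  by (simp add: tscale_def)

lemma tscale_zero [simp]: "c *\<^sub>t 0 = 0"
  by (rule ext) simp

lemma tscale_one [simp]: "1 *\<^sub>t x = x"
  by (rule ext) simp

lemma tscale_add: "c *\<^sub>t (x + y) = c *\<^sub>t x + c *\<^sub>t y"
  by (rule ext) (simp add: distrib_left)

lemma tensor_prod_Nil [simp]: "(a \<otimes>\<^sub>t b) [] = a [] * b []"
  by (simp add: tensor_prod_def)

lemma tensor_prod_Cons: "(a \<otimes>\<^sub>t b) (z # w) = a [] * b (z # w) + ((\<lambda>u. a (z # u)) \<otimes>\<^sub>t b) w"
  by (simp add: tensor_prod_def sum.atMost_Suc_shift del: sum.atMost_Suc)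

lemma tensor_prod_add_left: "(a + b) \<otimes>\<^sub>t c = a \<otimes>\<^sub>t c + b \<otimes>\<^sub>t c"
  by (rule ext) (simp add: tensor_prod_def distrib_right sum.distrib)

lemma tensor_prod_add_right: "a \<otimes>\<^sub>t (b + c) = a \<otimes>\<^sub>t b + a \<otimes>\<^sub>t c"
  by (rule ext) (simp add: tensor_prod_def distrib_left sum.distrib)

lemma tensor_prod_zero_left [simp]: "0 \<otimes>\<^sub>t a = 0"
  by (rule ext) (simp add: tensor_prod_def)

lemma tensor_prod_zero_right [simp]: "a \<otimes>\<^sub>t 0 = 0"
  by (rule ext) (simp add: tensor_prod_def)

lemma tensor_prod_tscale_left: "(c *\<^sub>t a) \<otimes>\<^sub>t b = c *\<^sub>t (a \<otimes>\<^sub>t b)"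
  by (rule ext) (simp add: tensor_prod_def sum_distrib_left mult.assoc)

lemma tensor_prod_tscale_right: "a \<otimes>\<^sub>t (c *\<^sub>t b) = c *\<^sub>t (a \<otimes>\<^sub>t b)"
  by (rule ext) (simp add: tensor_prod_def sum_distrib_left mult.left_commute)

lemma tensor_prod_unit_left [simp]: "tunit \<otimes>\<^sub>t a = a"
proof
  show "(tunit \<otimes>\<^sub>t a) w = a w" for w
  proof (cases w)
    case (Cons z v)
    have "(\<lambda>u. tunit (z # u)) = (0 :: 'a tensor)"
      by (simp add: tunit_def zero_fun_def)
    with Cons show ?thesis
      by (simp add: tensor_prod_Cons tunit_def)
  qed (simp add: tunit_def)
qed

lemma tensor_prod_unit_right [simp]: "a \<otimes>\<^sub>t tunit = a"
proof
  show "(a \<otimes>\<^sub>t tunit) w = a w" for w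
    by (induction w arbitrary: a) (simp_all add: tensor_prod_Cons tunit_def)
qed

lemma tensor_prod_assoc: "(a \<otimes>\<^sub>t b) \<otimes>\<^sub>t c = a \<otimes>\<^sub>t (b \<otimes>\<^sub>t c)"
proof
  show "((a \<otimes>\<^sub>t b) \<otimes>\<^sub>t c) w = (a \<otimes>\<^sub>t (b \<otimes>\<^sub>t c)) w" for w
  proof (induction w arbitrary: a b)
    case (Cons z w)
    have "(\<lambda>u. (a \<otimes>\<^sub>t b) (z # u)) = a [] *\<^sub>t (\<lambda>u. b (z # u)) + (\<lambda>u. a (z # u)) \<otimes>\<^sub>t b"
      by (rule ext) (simp add: tensor_prod_Cons)
    then show ?case
      using Cons by (simp add: tensor_prod_Cons tensor_prod_add_left tensor_prod_tscale_left
          algebra_simps)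
  qed simp
qed

lemma tensor_prod_list_append:
  "tensor_prod_list (xs @ ys) = tensor_prod_list xs \<otimes>\<^sub>t tensor_prod_list ys"
  by (induction xs) (simp_all add: tensor_prod_list_def tensor_prod_assoc)


section \<open>Levels of products, powers and logarithms\<close>

lemma lvl_apply: "lvl k x w = (if length w = k then x w else 0)"
  by (simp add: lvl_def)

lemma lvl_tscale: "lvl k (c *\<^sub>t x) = c *\<^sub>t lvl k x"
  by (rule ext) (simp add: lvl_apply)

lemma lvl_zero [simp]: "lvl k 0 = 0"
  by (rule ext) (simp add: lvl_apply)

lemma lvl_sum: "lvl k (\<Sum>i\<in>A. f i) = (\<Sum>i\<in>A. lvl k (f i))"
  by (rule ext) (simp add: lvl_apply tensor_sum_apply)

lemma lvl_tunit: "lvl k tunit = (if k = 0 then tunit else 0)"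
  by (rule ext) (auto simp: lvl_apply tunit_def)

lemma lvl_0: "x [] = 1 \<Longrightarrow> lvl 0 x = tunit"
  by (rule ext) (auto simp: lvl_apply tunit_def)

lemma lvl_prod_lvl:
  "lvl n (lvl i a \<otimes>\<^sub>t lvl j b) = (if n = i + j then lvl i a \<otimes>\<^sub>t lvl j b else 0)"
proof -
  have "(lvl i a \<otimes>\<^sub>t lvl j b) w = 0" if "length w \<noteq> i + j" for w
    unfolding tensor_prod_def using that by (intro sum.neutral) (auto simp: lvl_apply)
  then show ?thesis
    by (intro ext) (auto simp: lvl_apply)
qed

lemma lvl_tmult:
  assumes "n \<le> L"
  shows "lvl n (tmult L a x) = (\<Sum>l\<le>n. lvl l a \<otimes>\<^sub>t lvl (n - l) x)"
proof -
  have "lvl n (tmult L a x) =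
      (\<Sum>K\<le>L. if K = n then \<Sum>l\<le>K. lvl l a \<otimes>\<^sub>t lvl (K - l) x else 0)"
    unfolding tmult_def lvl_sum
    by (intro sum.cong refl) (auto simp: lvl_prod_lvl)
  with assms show ?thesis by simp
qed

lemma tmult_Nil: "tmult L a x [] = a [] * x []"
proof -
  have "tmult L a x [] = lvl 0 (tmult L a x) []"
    by (simp add: lvl_apply)
  then show ?thesis
    by (simp add: lvl_tmult lvl_apply)
qed

lemma tpower_Nil: "tpower L x k [] = x [] ^ k"
  by (induction k) (simp_all add: tmult_Nil tunit_def)

text \<open>
  If \<open>y n\<close> is the level \<open>n\<close> of a tensor with constant term \<open>1\<close>, then \<open>aug_power y k n\<close> is the
  level \<open>n\<close> of the \<open>k\<close>-th power of the difference of that tensor and the unit. Starting the sum at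
  \<open>1\<close> is what subtracting the unit amounts to.
\<close>

primrec aug_power :: "(nat \<Rightarrow> 'd tensor) \<Rightarrow> nat \<Rightarrow> nat \<Rightarrow> 'd tensor" where
  "aug_power y 0 n = (if n = 0 then tunit else 0)"
| "aug_power y (Suc k) n = (\<Sum>i=1..n. y i \<otimes>\<^sub>t aug_power y k (n - i))"

lemma aug_power_cong:
  "(\<And>i. 1 \<le> i \<Longrightarrow> i \<le> n \<Longrightarrow> y i = z i) \<Longrightarrow> aug_power y k n = aug_power z k n"
proof (induction k arbitrary: n)
  case (Suc k)
  have "y i \<otimes>\<^sub>t aug_power y k (n - i) = z i \<otimes>\<^sub>t aug_power z k (n - i)" if "i \<in> {1..n}" for i
    using that Suc.prems[of i] Suc.IH[of "n - i"] Suc.prems by simp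
  then show ?case by simp
qed simp

lemma lvl_tpower_minus_unit:
  assumes "y [] = 1" "n \<le> L"
  shows "lvl n (tpower L (y - tunit) k) = aug_power (\<lambda>i. lvl i y) k n"
proof -
  define u where "u = y - tunit"
  have level: "lvl l u = (if l = 0 then 0 else lvl l y)" for l
    using assms by (intro ext) (auto simp: u_def lvl_apply tunit_def)
  have "n \<le> L \<Longrightarrow> lvl n (tpower L u k) = aug_power (\<lambda>i. lvl i y) k n" for n
  proof (induction k arbitrary: n)
    case (Suc k)
    have "lvl n (tpower L u (Suc k)) =
        (\<Sum>l\<le>n. if l = 0 then 0 else lvl l y \<otimes>\<^sub>t aug_power (\<lambda>i. lvl i y) k (n - l))"
      using Suc by (simp add: lvl_tmult level if_distrib[of "\<lambda>u. u \<otimes>\<^sub>t _"] cong: if_cong)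
    also have "\<dots> = (\<Sum>l=1..n. lvl l y \<otimes>\<^sub>t aug_power (\<lambda>i. lvl i y) k (n - l))"
      by (intro sum.mono_neutral_cong_right) auto
    finally show ?case by simp
  qed (simp add: lvl_tunit)
  with assms(2) show ?thesis by (simp add: u_def)
qed

text \<open>
  Level \<open>n\<close> of the part of the logarithm series of degree at least \<open>2\<close>. The first factor of each power
  is split off and restricted to \<open>i < n\<close>: at \<open>i = n\<close> the other factors would have level \<open>0\<close> and the
  product vanishes. In this form \<open>y n\<close> visibly does not occur.
\<close>

definition log_remainder :: "nat \<Rightarrow> nat \<Rightarrow> (nat \<Rightarrow> 'd tensor) \<Rightarrow> 'd tensor" where
  "log_remainder L n y = (\<Sum>k=2..L. ((-1) ^ (k + 1) / real k) *\<^sub>t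
     (\<Sum>i=1..<n. y i \<otimes>\<^sub>t aug_power y (k - 1) (n - i)))"

lemma log_remainder_cong:
  assumes "\<And>i. 1 \<le> i \<Longrightarrow> i < n \<Longrightarrow> y i = z i"
  shows "log_remainder L n y = log_remainder L n z"
proof -
  have "y i \<otimes>\<^sub>t aug_power y k (n - i) = z i \<otimes>\<^sub>t aug_power z k (n - i)" if "i \<in> {1..<n}" for i k
    using that assms by (intro arg_cong2[of _ _ _ _ tensor_prod] aug_power_cong) auto
  then show ?thesis by (simp add: log_remainder_def)
qed

text \<open>
  The linear term of the logarithm contributes level \<open>n\<close> of \<open>y\<close> itself. In every product of two
  or more augmented factors each factor has level at least \<open>1\<close>, so that level \<open>n\<close> of such a product
  contains only levels of \<open>y\<close> below \<open>n\<close>.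
\<close>

lemma lvl_tlog:
  assumes "y [] = 1" "1 \<le> n" "n \<le> L"
  shows "lvl n (tlog L y) = lvl n y + log_remainder L n (\<lambda>i. lvl i y)"
proof -
  let ?y = "\<lambda>i. lvl i y"
  let ?c = "\<lambda>k. (-1) ^ (k + 1) / real k"
  have linear: "aug_power ?y 1 n = ?y n"
  proof -
    have "aug_power ?y 1 n = (\<Sum>i=1..n. if i = n then ?y i else 0)"
      unfolding One_nat_def aug_power.simps by (intro sum.cong) auto
    with assms(2) show ?thesis by simp
  qed
  have higher: "aug_power ?y k n = (\<Sum>i=1..<n. ?y i \<otimes>\<^sub>t aug_power ?y (k - 1) (n - i))"
    if "k \<in> {2..L}" for k
  proof -
    define j where "j = k - 2"
    then have j: "k = Suc (Suc j)"
      using \<open>k \<in> {2..L}\<close> by auto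
    have "{1..n} = insert n {1..<n}"
      using assms(2) by auto
    then show ?thesis by (simp add: j)
  qed
  have "{1..L} = insert 1 {2..L}"
    using assms by auto
  moreover have "lvl n (tlog L y) = (\<Sum>k=1..L. ?c k *\<^sub>t aug_power ?y k n)"
    using assms by (simp add: tlog_def lvl_sum lvl_tscale lvl_tpower_minus_unit)
  ultimately have "lvl n (tlog L y) =
      aug_power ?y 1 n + (\<Sum>k=2..L. ?c k *\<^sub>t aug_power ?y k n)"
    by simp
  also have "(\<Sum>k=2..L. ?c k *\<^sub>t aug_power ?y k n) = log_remainder L n ?y"
    unfolding log_remainder_def using higher by (intro sum.cong) simp_all
  finally show ?thesis
    by (simp only: linear)
qed


section \<open>Constant terms\<close>

text \<open>
  The tensors without constant term form a Lie algebra that contains level \<open>1\<close>, since constant terms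
  multiply and so cancel in a commutator.
\<close>

lemma free_lie_algebra_Nil:
  fixes v :: "'d tensor"
  assumes "1 \<le> L" "v \<in> free_lie_algebra L"
  shows "v [] = 0"
proof -
  let ?V = "{v \<in> trunc_tensors L. v [] = 0} :: 'd tensor set"
  have trunc: "tmult L x y w = 0" if "L < length w" for x y :: "'d tensor" and w
  proof -
    have "lvl l x \<otimes>\<^sub>t lvl (K - l) y = lvl K (lvl l x \<otimes>\<^sub>t lvl (K - l) y)" if "l \<le> K" for l K
      using that by (simp add: lvl_prod_lvl)
    then have "(lvl l x \<otimes>\<^sub>t lvl (K - l) y) w = 0" if "l \<le> K" "K \<le> L" for l K
      using that \<open>L < length w\<close> by (metis leD lvl_apply)
    then show ?thesis
      by (simp add: tmult_def tensor_sum_apply)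
  qed
  have "lie_subalgebra L ?V"
    by (auto simp: lie_subalgebra_def trunc_tensors_def trunc tmult_Nil)
  moreover have "homogeneous 1 \<subseteq> ?V"
    using assms(1) by (auto simp: homogeneous_def trunc_tensors_def)
  ultimately have "v \<in> ?V"
    using assms(2) unfolding free_lie_algebra_def by blast
  then show ?thesis by simp
qed

lemma power_series_Nil:
  assumes "x [] = 0"
  shows "(\<Sum>k\<le>L. c k *\<^sub>t tpower L x k) [] = c 0"
proof -
  have "(\<Sum>k\<le>L. c k *\<^sub>t tpower L x k) [] = (\<Sum>k\<le>L. if k = 0 then c k else 0)"
    using assms by (simp add: tensor_sum_apply tpower_Nil power_0_left if_distrib cong: if_cong)
  then show ?thesis by simp
qed

lemma free_lie_group_Nil:
  assumes "1 \<le> L" "m \<in> free_lie_group L"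
  shows "m [] = 1"
proof -
  obtain v where v: "v \<in> free_lie_algebra L" "m = texp L v"
    using assms(2) by (auto simp: free_lie_group_def)
  from power_series_Nil[of v "\<lambda>k. 1 / fact k", OF free_lie_algebra_Nil[OF assms(1) v(1)]]
  show ?thesis
    by (simp add: v(2) texp_def)
qed

lemma tinverse_Nil: "m [] = 1 \<Longrightarrow> tinverse L m [] = 1"
  by (simp add: tinverse_def power_series_Nil tunit_def)

lemma IIS_Nil: "IIS L \<tau> X [] = 1"
  by (simp add: IIS_def)


section \<open>Closure properties of noncommutative polynomials\<close>

lemma nc_polynomial_zero: "nc_polynomial ks K (\<lambda>xs. 0)"
  unfolding nc_polynomial_def by (rule exI[of _ "[]"]) simp

lemma nc_polynomial_unit: "nc_polynomial ks 0 (\<lambda>xs. tunit)"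
  unfolding nc_polynomial_def by (rule exI[of _ "[(1, [])]"]) (simp add: tensor_prod_list_def)

lemma nc_polynomial_arg: "j < length ks \<Longrightarrow> ks ! j = k \<Longrightarrow> nc_polynomial ks k (\<lambda>xs. xs ! j)"
  unfolding nc_polynomial_def by (rule exI[of _ "[(1, [j])]"]) (simp add: tensor_prod_list_def)

lemma nc_polynomial_add:
  assumes "nc_polynomial ks K F" "nc_polynomial ks K G"
  shows "nc_polynomial ks K (\<lambda>xs. F xs + G xs)"
proof -
  obtain P Q where
    "\<forall>(c, js)\<in>set P. set js \<subseteq> {..<length ks} \<and> (\<Sum>j\<leftarrow>js. ks ! j) = K"
    "\<forall>xs. length xs = length ks \<and> (\<forall>j<length ks. xs ! j \<in> homogeneous (ks ! j)) \<longrightarrow>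
       F xs = (\<Sum>(c, js)\<leftarrow>P. c *\<^sub>t tensor_prod_list (map ((!) xs) js))"
    "\<forall>(c, js)\<in>set Q. set js \<subseteq> {..<length ks} \<and> (\<Sum>j\<leftarrow>js. ks ! j) = K"
    "\<forall>xs. length xs = length ks \<and> (\<forall>j<length ks. xs ! j \<in> homogeneous (ks ! j)) \<longrightarrow>
       G xs = (\<Sum>(c, js)\<leftarrow>Q. c *\<^sub>t tensor_prod_list (map ((!) xs) js))"
    using assms unfolding nc_polynomial_def by blast
  then show ?thesis
    unfolding nc_polynomial_def by (intro exI[of _ "P @ Q"]) auto
qed

lemma nc_polynomial_sum:
  "finite A \<Longrightarrow> (\<And>i. i \<in> A \<Longrightarrow> nc_polynomial ks K (F i)) \<Longrightarrow>
     nc_polynomial ks K (\<lambda>xs. \<Sum>i\<in>A. F i xs)"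
  by (induction A rule: finite_induct) (auto intro: nc_polynomial_zero nc_polynomial_add)

lemma sum_list_terms_prod:
  fixes xs :: "'d tensor list"
  defines "ev \<equiv> (\<lambda>P. \<Sum>(c, js)\<leftarrow>P. c *\<^sub>t tensor_prod_list (map ((!) xs) js))"
  shows "ev P \<otimes>\<^sub>t ev Q = ev [(c * c', js @ js'). (c, js) \<leftarrow> P, (c', js') \<leftarrow> Q]"
proof (induction P)
  case (Cons p P)
  obtain c js where p: "p = (c, js)" by (cases p)
  have "(c *\<^sub>t tensor_prod_list (map ((!) xs) js)) \<otimes>\<^sub>t ev Q =
      ev [(c * c', js @ js'). (c', js') \<leftarrow> Q]"
  proof (induction Q)
    case (Cons q Q)
    have "c' *\<^sub>t c *\<^sub>t z = (c * c') *\<^sub>t z" for c' and z :: "'d tensor"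
      by (rule ext) simp
    with Cons show ?case
      by (cases q) (simp add: ev_def tensor_prod_add_right tensor_prod_tscale_left
          tensor_prod_tscale_right tensor_prod_list_append tscale_add del: plus_fun_apply tscale_apply)
  qed (simp add: ev_def del: zero_fun_apply tscale_apply)
  with Cons show ?case
    by (simp add: p ev_def tensor_prod_add_left del: plus_fun_apply tscale_apply)
qed (simp add: ev_def del: zero_fun_apply)

lemma nc_polynomial_prod:
  assumes "nc_polynomial ks I F" "nc_polynomial ks J G" "I + J = K"
  shows "nc_polynomial ks K (\<lambda>xs. F xs \<otimes>\<^sub>t G xs)"
proof -
  obtain P Q where
    "\<forall>(c, js)\<in>set P. set js \<subseteq> {..<length ks} \<and> (\<Sum>j\<leftarrow>js. ks ! j) = I"
    "\<forall>xs. length xs = length ks \<and> (\<forall>j<length ks. xs ! j \<in> homogeneous (ks ! j)) \<longrightarrow>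
       F xs = (\<Sum>(c, js)\<leftarrow>P. c *\<^sub>t tensor_prod_list (map ((!) xs) js))"
    "\<forall>(c, js)\<in>set Q. set js \<subseteq> {..<length ks} \<and> (\<Sum>j\<leftarrow>js. ks ! j) = J"
    "\<forall>xs. length xs = length ks \<and> (\<forall>j<length ks. xs ! j \<in> homogeneous (ks ! j)) \<longrightarrow>
       G xs = (\<Sum>(c, js)\<leftarrow>Q. c *\<^sub>t tensor_prod_list (map ((!) xs) js))"
    using assms unfolding nc_polynomial_def by blast
  then show ?thesis
    unfolding nc_polynomial_def using assms(3)
    by (intro exI[of _ "[(c * c', js @ js'). (c, js) \<leftarrow> P, (c', js') \<leftarrow> Q]"])
      (fastforce simp: sum_list_terms_prod)
qed

lemma nc_polynomial_tscale:
  assumes "nc_polynomial ks K F"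
  shows "nc_polynomial ks K (\<lambda>xs. c *\<^sub>t F xs)"
proof -
  have "nc_polynomial ks 0 (\<lambda>xs. c *\<^sub>t tunit)"
    unfolding nc_polynomial_def by (rule exI[of _ "[(c, [])]"]) (simp add: tensor_prod_list_def)
  from nc_polynomial_prod[OF this assms] show ?thesis
    by (simp add: tensor_prod_tscale_left)
qed

lemma nc_polynomial_aug_power:
  "(\<And>i. 1 \<le> i \<Longrightarrow> i \<le> n \<Longrightarrow> nc_polynomial ks i (\<lambda>xs. y xs i)) \<Longrightarrow>
     nc_polynomial ks n (\<lambda>xs. aug_power (y xs) k n)"
proof (induction k arbitrary: n)
  case 0
  then show ?case
    by (cases n) (simp_all add: nc_polynomial_unit nc_polynomial_zero del: zero_fun_apply)
next
  case (Suc k)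
  have "nc_polynomial ks n (\<lambda>xs. y xs i \<otimes>\<^sub>t aug_power (y xs) k (n - i))" if "i \<in> {1..n}" for i
    using that by (intro nc_polynomial_prod[of _ i _ "n - i"] Suc) auto
  then show ?case
    unfolding aug_power.simps by (intro nc_polynomial_sum) auto
qed

lemma nc_polynomial_log_remainder:
  assumes "\<And>i. 1 \<le> i \<Longrightarrow> i < n \<Longrightarrow> nc_polynomial ks i (\<lambda>xs. y xs i)"
  shows "nc_polynomial ks n (\<lambda>xs. log_remainder L n (y xs))"
proof -
  have "nc_polynomial ks n (\<lambda>xs. y xs i \<otimes>\<^sub>t aug_power (y xs) k (n - i))"
    if "i \<in> {1..<n}" for i k
    using that by (intro nc_polynomial_prod[of _ i _ "n - i"] nc_polynomial_aug_power assms) auto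
  then show ?thesis
    unfolding log_remainder_def
    by (intro nc_polynomial_sum nc_polynomial_tscale) auto
qed


section \<open>The recursion for the inverse of the group mean\<close>

text \<open>
  The arguments are listed as \<open>a\<^sub>0, \<dots>, a\<^bsub>K-1\<^esub>, x\<^sub>1, x\<^sub>2, \<dots>\<close>, so that \<open>x\<^sub>j\<close> sits at
  position \<open>K + j - 1\<close>; the level \<open>x\<^sub>0\<close> is not an argument and is replaced by the unit, its value
  for every element of the group.
\<close>

definition x_arg :: "nat \<Rightarrow> 'd tensor list \<Rightarrow> nat \<Rightarrow> 'd tensor" where
  "x_arg K xs j = (if j = 0 then tunit else xs ! (K + j - 1))"

definition prod_poly :: "nat \<Rightarrow> 'd tensor list \<Rightarrow> 'd tensor" where
  "prod_poly K xs = (\<Sum>l<K. xs ! l \<otimes>\<^sub>t x_arg K xs (K - l))"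

definition log_poly :: "nat \<Rightarrow> nat \<Rightarrow> 'd tensor list \<Rightarrow> 'd tensor" where
  "log_poly L K xs = log_remainder L K (\<lambda>n. \<Sum>l\<le>n. xs ! l \<otimes>\<^sub>t x_arg K xs (n - l))"

lemma nc_polynomial_x_arg:
  assumes "j < M" "M \<le> K + 1"
  shows "nc_polynomial ([0..<K] @ [1..<M]) j (\<lambda>xs. x_arg K xs j)"
proof (cases "j = 0")
  case True
  then show ?thesis by (simp add: x_arg_def nc_polynomial_unit)
next
  case False
  then show ?thesis
    using assms by (auto simp: x_arg_def nth_append intro!: nc_polynomial_arg)
qed

lemma nc_polynomial_prod_poly: "nc_polynomial ([0..<K] @ [1..<K + 1]) K (prod_poly K)"
proof -
  have "nc_polynomial ([0..<K] @ [1..<K + 1]) K (\<lambda>xs. xs ! l \<otimes>\<^sub>t x_arg K xs (K - l))"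
    if "l < K" for l
    using that by (intro nc_polynomial_prod[of _ l _ "K - l"] nc_polynomial_arg
        nc_polynomial_x_arg) (auto simp: nth_append)
  then have "nc_polynomial ([0..<K] @ [1..<K + 1]) K
      (\<lambda>xs. \<Sum>l<K. xs ! l \<otimes>\<^sub>t x_arg K xs (K - l))"
    by (intro nc_polynomial_sum) auto
  then show ?thesis
    by (simp add: prod_poly_def[abs_def])
qed

lemma nc_polynomial_log_poly: "nc_polynomial ([0..<K] @ [1..<K]) K (log_poly L K)"
proof -
  have "nc_polynomial ([0..<K] @ [1..<K]) n (\<lambda>xs. \<Sum>l\<le>n. xs ! l \<otimes>\<^sub>t x_arg K xs (n - l))"
    if "n < K" for n
  proof (rule nc_polynomial_sum)
    show "nc_polynomial ([0..<K] @ [1..<K]) n (\<lambda>xs. xs ! l \<otimes>\<^sub>t x_arg K xs (n - l))"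
      if "l \<in> {..n}" for l
      using that \<open>n < K\<close>
      by (intro nc_polynomial_prod[of _ l _ "n - l"] nc_polynomial_arg nc_polynomial_x_arg)
        (auto simp: nth_append)
  qed simp
  then have "nc_polynomial ([0..<K] @ [1..<K]) K
      (\<lambda>xs. log_remainder L K (\<lambda>n. \<Sum>l\<le>n. xs ! l \<otimes>\<^sub>t x_arg K xs (n - l)))"
    by (intro nc_polynomial_log_remainder) auto
  then show ?thesis
    by (simp add: log_poly_def[abs_def])
qed

lemma x_arg_levels:
  assumes "x [] = 1" "j < M" "M \<le> K + 1"
  shows "x_arg K (map (\<lambda>k. lvl k a) [0..<K] @ map (\<lambda>k. lvl k x) [1..<M]) j = lvl j x"
  using assms by (auto simp: x_arg_def lvl_0 nth_append)

text \<open>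
  Level \<open>K\<close> of a product \<open>a x\<close> is \<open>a\<^sub>K\<close> plus terms with lower levels of \<open>a\<close>, because \<open>x\<^sub>0 = 1\<close>; by
  triangularity of the logarithm the same is true of \<open>log (a x)\<close>.
\<close>

lemma lvl_tlog_tmult:
  assumes "a [] = 1" "x [] = 1" "1 \<le> K" "K \<le> L"
  shows "lvl K (tlog L (tmult L a x)) = lvl K a +
      (prod_poly K (map (\<lambda>k. lvl k a) [0..<K] @ map (\<lambda>k. lvl k x) [1..<K + 1]) +
       log_poly L K (map (\<lambda>k. lvl k a) [0..<K] @ map (\<lambda>k. lvl k x) [1..<K]))"
proof -
  let ?xs = "\<lambda>M. map (\<lambda>k. lvl k a) [0..<K] @ map (\<lambda>k. lvl k x) [1..<M]"
  have "{..K} = insert K {..<K}" by auto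
  then have "lvl K (tmult L a x) = lvl K a + (\<Sum>l<K. lvl l a \<otimes>\<^sub>t lvl (K - l) x)"
    using assms by (simp add: lvl_tmult lvl_0)
  also have "(\<Sum>l<K. lvl l a \<otimes>\<^sub>t lvl (K - l) x) = prod_poly K (?xs (K + 1))"
    unfolding prod_poly_def using assms
    by (intro sum.cong refl, subst x_arg_levels) (auto simp: nth_append)
  finally have product: "lvl K (tmult L a x) = lvl K a + prod_poly K (?xs (K + 1))" .
  have remainder: "log_remainder L K (\<lambda>n. lvl n (tmult L a x)) = log_poly L K (?xs K)"
    unfolding log_poly_def
  proof (rule log_remainder_cong)
    fix n assume n: "1 \<le> n" "n < K"
    then show "lvl n (tmult L a x) = (\<Sum>l\<le>n. ?xs K ! l \<otimes>\<^sub>t x_arg K (?xs K) (n - l))"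
      using assms by (subst lvl_tmult, simp, intro sum.cong refl, subst x_arg_levels)
        (auto simp: nth_append)
  qed
  have "tmult L a x [] = 1"
    using assms by (simp add: tmult_Nil)
  from lvl_tlog[of "tmult L a x", OF this assms(3,4)] show ?thesis
    by (simp only: product remainder add.assoc)
qed

lemma affine_solution:
  fixes b :: "'d tensor"
  assumes "(\<Sum>i\<in>A. wt i) = 1" "(\<Sum>i\<in>A. wt i *\<^sub>t (b + f i)) = 0"
  shows "b = - (\<Sum>i\<in>A. wt i *\<^sub>t f i)"
proof
  fix w
  have "(\<Sum>i\<in>A. wt i * b w) + (\<Sum>i\<in>A. wt i * f i w) = 0"
    using fun_cong[OF assms(2), of w]
    by (simp add: tensor_sum_apply distrib_left sum.distrib)
  then show "b w = (- (\<Sum>i\<in>A. wt i *\<^sub>t f i)) w"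
    using assms(1) by (simp add: tensor_sum_apply flip: sum_distrib_right)
qed

theorem proposition34:
  fixes L :: nat
  assumes "L \<ge> 1"
  shows "\<exists>(p :: nat \<Rightarrow> 'd::finite tensor list \<Rightarrow> 'd tensor)
          (q :: nat \<Rightarrow> 'd tensor list \<Rightarrow> 'd tensor).
    (\<forall>K\<in>{2..L}.
       nc_polynomial ([0..<K] @ [1..<K + 1]) K (q K) \<and>
       nc_polynomial ([0..<K] @ [1..<K]) K (p K)) \<and>
    (\<forall>(N::nat) (\<tau>::real) (X :: nat \<Rightarrow> real \<Rightarrow> real ^ 'd) (wt :: nat \<Rightarrow> real)
       (x :: nat \<Rightarrow> 'd tensor) (m :: 'd tensor) (a :: 'd tensor).
       N \<ge> 1 \<longrightarrow> \<tau> > 0 \<longrightarrow> (\<forall>i\<in>{1..N}. bv_path \<tau> (X i)) \<longrightarrow>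
       (\<Sum>i=1..N. wt i) = 1 \<longrightarrow>
       (\<forall>i\<in>{1..N}. x i = IIS L \<tau> (X i)) \<longrightarrow>
       is_group_mean L N wt x m \<longrightarrow>
       a = tinverse L m \<longrightarrow>
       lvl 1 a = - (\<Sum>i=1..N. wt i *\<^sub>t lvl 1 (x i)) \<and>
       (\<forall>K\<in>{2..L}.
          lvl K a = - (\<Sum>i=1..N. wt i *\<^sub>t
            (q K (map (\<lambda>k. lvl k a) [0..<K] @ map (\<lambda>k. lvl k (x i)) [1..<K + 1]) +
             p K (map (\<lambda>k. lvl k a) [0..<K] @ map (\<lambda>k. lvl k (x i)) [1..<K])))))"
proof (intro exI conjI allI ballI impI)
  fix K
  show "nc_polynomial ([0..<K] @ [1..<K + 1]) K (prod_poly K :: 'd tensor list \<Rightarrow> _)"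
    by (rule nc_polynomial_prod_poly)
  show "nc_polynomial ([0..<K] @ [1..<K]) K (log_poly L K :: 'd tensor list \<Rightarrow> _)"
    by (rule nc_polynomial_log_poly)
next
  fix N :: nat and \<tau> :: real and X :: "nat \<Rightarrow> real \<Rightarrow> real ^ 'd" and wt :: "nat \<Rightarrow> real"
    and x :: "nat \<Rightarrow> 'd tensor" and m a :: "'d tensor"
  assume wt: "(\<Sum>i=1..N. wt i) = 1"
    and x: "\<forall>i\<in>{1..N}. x i = IIS L \<tau> (X i)"
    and m: "is_group_mean L N wt x m"
    and a: "a = tinverse L m"
  have a0: "a [] = 1"
    unfolding a using m assms unfolding is_group_mean_def
    by (intro tinverse_Nil free_lie_group_Nil) auto
  have x0: "x i [] = 1" if "i \<in> {1..N}" for i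
    using that x by (simp add: IIS_Nil)
  have rec: "lvl K a = - (\<Sum>i=1..N. wt i *\<^sub>t
      (prod_poly K (map (\<lambda>k. lvl k a) [0..<K] @ map (\<lambda>k. lvl k (x i)) [1..<K + 1]) +
       log_poly L K (map (\<lambda>k. lvl k a) [0..<K] @ map (\<lambda>k. lvl k (x i)) [1..<K])))"
    (is "_ = - (\<Sum>i=1..N. wt i *\<^sub>t ?r i)")
    if K: "1 \<le> K" "K \<le> L" for K
  proof (rule affine_solution[OF wt])
    have "(\<Sum>i=1..N. wt i *\<^sub>t (lvl K a + ?r i)) =
        (\<Sum>i=1..N. wt i *\<^sub>t lvl K (tlog L (tmult L a (x i))))"
      using a0 x0 K by (intro sum.cong refl) (simp add: lvl_tlog_tmult)
    also have "\<dots> = lvl K (\<Sum>i=1..N. wt i *\<^sub>t tlog L (tmult L a (x i)))"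
      by (simp add: lvl_sum lvl_tscale)
    also have "\<dots> = 0"
      using m by (simp add: is_group_mean_def a)
    finally show "(\<Sum>i=1..N. wt i *\<^sub>t (lvl K a + ?r i)) = 0" .
  qed
  show "lvl K a = - (\<Sum>i=1..N. wt i *\<^sub>t
      (prod_poly K (map (\<lambda>k. lvl k a) [0..<K] @ map (\<lambda>k. lvl k (x i)) [1..<K + 1]) +
       log_poly L K (map (\<lambda>k. lvl k a) [0..<K] @ map (\<lambda>k. lvl k (x i)) [1..<K])))"
    if "K \<in> {2..L}" for K
    using that rec by simp
  show "lvl 1 a = - (\<Sum>i=1..N. wt i *\<^sub>t lvl 1 (x i))"
  proof -
    \<comment> \<open>At level \<open>1\<close> the logarithm has no remainder, and \<open>a\<^sub>0 \<otimes> x\<^sub>1\<close> is the only product left.\<close>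
    have "prod_poly 1 (map (\<lambda>k. lvl k a) [0..<1] @ map (\<lambda>k. lvl k y) [1..<1 + 1]) = lvl 1 y"
      for y :: "'d tensor"
      using a0 by (simp add: prod_poly_def x_arg_def lvl_0)
    moreover have "log_poly L 1 xs = 0" for xs :: "'d tensor list"
      by (simp add: log_poly_def log_remainder_def)
    ultimately show ?thesis
      using rec[of 1] assms by simp
  qed
qed

end
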